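(* Let $G$ be a normally finitely generated group and let $n\in\mathbb{N}$. Suppose that $\dim Q(G)\ge n$. Then there exists a quasiisometric embedding $\mathbb{Z}^n\to G$, where $\mathbb{Z}^n$ is equipped with the standard word metric and $G$ is equipped with the biinvariant word metric.
   Context: A group $G$ is normally finitely generated if there is a finite symmetric set $S\subset G$ such that the set $\overline S$ of all conjugates of elements of $S$ generates $G$. The biinvariant word norm is $\|g\|=\min\{k\ge0 : g=s_1\cdots s_k,\ s_i\in\overline S\}$ and the biinvariant word metric is $\mathbf{d}(g,h)=\|gh^{-1}\|$ (well defined up to Lipschitz equivalence). A quasimorphism on $G$ is a function $q\colon G\to\mathbb{R}$ for which there is $A\ge0$ with $|q(gh)-q(g)-q(h)|\le A$ for all $g,h$; it is homogeneous if $q(g^n)=nq(g)$ for all $g\in G$ and $n\in\mathbb{Z}$. $Q(G)$ is the real vector space of homogeneous quasimorphisms on $G$. A map between metric spaces is a quasiisometric embedding if it is a quasiisometry onto its image, i.e. there are $C\ge1$, $D\ge0$ with $\frac1C d(x,y)-D\le d(f(x),f(y))\le C d(x,y)+D$ for all $x,y$. *)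

theory Defs
  imports Complex_Main "HOL-Library.Extended_Nat" "HOL-Library.Function_Algebras"
    "HOL-Algebra.Product_Groups"
begin

definition conjugates :: "('a, 'b) monoid_scheme \<Rightarrow> 'a set \<Rightarrow> 'a set"
  where "conjugates G S =
    {g \<otimes>\<^bsub>G\<^esub> s \<otimes>\<^bsub>G\<^esub> inv\<^bsub>G\<^esub> g | g s. g \<in> carrier G \<and> s \<in> S}"

definition finite_normal_generating_set :: "('a, 'b) monoid_scheme \<Rightarrow> 'a set \<Rightarrow> bool"
  where "finite_normal_generating_set G S \<longleftrightarrow>
    finite S \<and> S \<subseteq> carrier G \<and> set_inv\<^bsub>G\<^esub> S = S \<and> generate G (conjugates G S) = carrier G"

definition normally_finitely_generated :: "('a, 'b) monoid_scheme \<Rightarrow> bool"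
  where "normally_finitely_generated G \<longleftrightarrow> (\<exists>S. finite_normal_generating_set G S)"

text \<open>
  The word norm is only meaningful for a symmetric set \<open>T\<close> generating \<open>G\<close>: the set of
  lengths is then nonempty for every element of the carrier.
\<close>

definition word_norm :: "('a, 'b) monoid_scheme \<Rightarrow> 'a set \<Rightarrow> 'a \<Rightarrow> nat"
  where "word_norm G T g =
    (LEAST k. \<exists>ss. length ss = k \<and> set ss \<subseteq> T \<and> foldr (\<otimes>\<^bsub>G\<^esub>) ss \<one>\<^bsub>G\<^esub> = g)"

definition word_metric :: "('a, 'b) monoid_scheme \<Rightarrow> 'a set \<Rightarrow> 'a \<Rightarrow> 'a \<Rightarrow> real"
  where "word_metric G T g h = real (word_norm G T (g \<otimes>\<^bsub>G\<^esub> inv\<^bsub>G\<^esub> h))"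

definition biinvariant_word_metric :: "('a, 'b) monoid_scheme \<Rightarrow> 'a set \<Rightarrow> 'a \<Rightarrow> 'a \<Rightarrow> real"
  where "biinvariant_word_metric G S = word_metric G (conjugates G S)"

definition Zn :: "nat \<Rightarrow> (nat \<Rightarrow> int) monoid"
  where "Zn n = product_group {..<n} (\<lambda>_. integer_group)"

text \<open>The vectors \<open>\<plusminus>e\<^sub>j\<close>; as elements of a product group they are \<open>undefined\<close> outside \<open>{..<n}\<close>.\<close>

definition Zn_generators :: "nat \<Rightarrow> (nat \<Rightarrow> int) set"
  where "Zn_generators n =
    {(\<lambda>i\<in>{..<n}. if i = j then c else 0) | j c. j < n \<and> c \<in> {1, -1}}"

definition Zn_metric :: "nat \<Rightarrow> (nat \<Rightarrow> int) \<Rightarrow> (nat \<Rightarrow> int) \<Rightarrow> real"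
  where "Zn_metric n = word_metric (Zn n) (Zn_generators n)"

definition quasiisometric_embedding ::
    "'a set \<Rightarrow> ('a \<Rightarrow> 'a \<Rightarrow> real) \<Rightarrow> 'b set \<Rightarrow> ('b \<Rightarrow> 'b \<Rightarrow> real) \<Rightarrow> ('a \<Rightarrow> 'b) \<Rightarrow> bool"
  where "quasiisometric_embedding X dX Y dY f \<longleftrightarrow> f \<in> X \<rightarrow> Y \<and>
    (\<exists>C D :: real. C \<ge> 1 \<and> D \<ge> 0 \<and>
      (\<forall>x\<in>X. \<forall>y\<in>X. 1 / C * dX x y - D \<le> dY (f x) (f y) \<and> dY (f x) (f y) \<le> C * dX x y + D))"

definition quasimorphism :: "('a, 'b) monoid_scheme \<Rightarrow> ('a \<Rightarrow> real) \<Rightarrow> bool"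
  where "quasimorphism G q \<longleftrightarrow>
    (\<exists>A\<ge>0. \<forall>g\<in>carrier G. \<forall>h\<in>carrier G. \<bar>q (g \<otimes>\<^bsub>G\<^esub> h) - q g - q h\<bar> \<le> A)"

definition homogeneous :: "('a, 'b) monoid_scheme \<Rightarrow> ('a \<Rightarrow> real) \<Rightarrow> bool"
  where "homogeneous G q \<longleftrightarrow>
    (\<forall>g\<in>carrier G. \<forall>n::int. q (g [^]\<^bsub>G\<^esub> n) = of_int n * q g)"

text \<open>
  A function on the carrier is represented by its extension by \<open>0\<close> to the whole type, so that
  distinct members of \<open>Q G\<close> differ on the carrier and \<open>Q G\<close> is closed under the pointwise
  vector space operations (which would fail for extension by \<open>undefined\<close>).
\<close>

definition Q :: "('a, 'b) monoid_scheme \<Rightarrow> ('a \<Rightarrow> real) set"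
  where "Q G = {q. quasimorphism G q \<and> homogeneous G q \<and> (\<forall>x. x \<notin> carrier G \<longrightarrow> q x = 0)}"

definition scale_fun :: "real \<Rightarrow> ('a \<Rightarrow> real) \<Rightarrow> 'a \<Rightarrow> real"
  where "scale_fun c f = (\<lambda>x. c * f x)"

global_interpretation real_fun: vector_space "scale_fun :: real \<Rightarrow> ('a \<Rightarrow> real) \<Rightarrow> 'a \<Rightarrow> real"
  by unfold_locales (auto simp: scale_fun_def fun_eq_iff algebra_simps)

lemma subspace_Q: "real_fun.subspace (Q G)"
  unfolding real_fun.subspace_def
proof (intro conjI ballI allI)
  show "0 \<in> Q G"
    by (auto simp: Q_def quasimorphism_def homogeneous_def)
next
  fix p q assume pq: "p \<in> Q G" "q \<in> Q G"
  obtain A where A: "A \<ge> 0"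
    "\<And>g h. g \<in> carrier G \<Longrightarrow> h \<in> carrier G \<Longrightarrow> \<bar>p (g \<otimes>\<^bsub>G\<^esub> h) - p g - p h\<bar> \<le> A"
    using pq(1) by (auto simp: Q_def quasimorphism_def)
  obtain B where B: "B \<ge> 0"
    "\<And>g h. g \<in> carrier G \<Longrightarrow> h \<in> carrier G \<Longrightarrow> \<bar>q (g \<otimes>\<^bsub>G\<^esub> h) - q g - q h\<bar> \<le> B"
    using pq(2) by (auto simp: Q_def quasimorphism_def)
  have "quasimorphism G (p + q)"
    unfolding quasimorphism_def
  proof (intro exI[of _ "A + B"] conjI ballI)
    fix g h assume "g \<in> carrier G" "h \<in> carrier G"
    from A(2)[OF this] B(2)[OF this]
    show "\<bar>(p + q) (g \<otimes>\<^bsub>G\<^esub> h) - (p + q) g - (p + q) h\<bar> \<le> A + B" by simp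
  qed (use A B in simp)
  then show "p + q \<in> Q G"
    using pq by (auto simp: Q_def homogeneous_def algebra_simps)
next
  fix c q assume q: "q \<in> Q G"
  obtain A where A: "A \<ge> 0"
    "\<And>g h. g \<in> carrier G \<Longrightarrow> h \<in> carrier G \<Longrightarrow> \<bar>q (g \<otimes>\<^bsub>G\<^esub> h) - q g - q h\<bar> \<le> A"
    using q by (auto simp: Q_def quasimorphism_def)
  have "quasimorphism G (scale_fun c q)"
    unfolding quasimorphism_def
  proof (intro exI[of _ "\<bar>c\<bar> * A"] conjI ballI)
    fix g h assume gh: "g \<in> carrier G" "h \<in> carrier G"
    have "scale_fun c q (g \<otimes>\<^bsub>G\<^esub> h) - scale_fun c q g - scale_fun c q h
        = c * (q (g \<otimes>\<^bsub>G\<^esub> h) - q g - q h)"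
      by (simp add: scale_fun_def algebra_simps)
    then show "\<bar>scale_fun c q (g \<otimes>\<^bsub>G\<^esub> h) - scale_fun c q g - scale_fun c q h\<bar> \<le> \<bar>c\<bar> * A"
      using A(2)[OF gh] by (simp add: abs_mult mult_left_mono)
  qed (use A in simp)
  then show "scale_fun c q \<in> Q G"
    using q by (auto simp: Q_def homogeneous_def scale_fun_def)
qed

text \<open>
  The library's \<open>dim\<close> is \<open>0\<close> on infinite-dimensional spaces, whereas \<open>Q G\<close> may well be
  infinite-dimensional; hence the variant with value \<open>\<infinity>\<close> there.
\<close>

definition edim :: "('a \<Rightarrow> real) set \<Rightarrow> enat"
  where "edim V =
    (let B = (SOME B. B \<subseteq> V \<and> real_fun.independent B \<and> V \<subseteq> real_fun.span B)
     in if finite B then enat (card B) else \<infinity>)"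

lemma edim_eq_basis:
  assumes "B \<subseteq> V" "real_fun.independent B" "V \<subseteq> real_fun.span B"
  shows "edim V = (if finite B then enat (card B) else \<infinity>)"
proof -
  define C where "C = (SOME B. B \<subseteq> V \<and> real_fun.independent B \<and> V \<subseteq> real_fun.span B)"
  have C: "C \<subseteq> V \<and> real_fun.independent C \<and> V \<subseteq> real_fun.span C"
    unfolding C_def by (rule someI[of _ B]) (use assms in blast)
  have "real_fun.span B = real_fun.span C"
    using assms C by (meson order.trans real_fun.span_minimal real_fun.subspace_span subset_antisym)
  then obtain f where f: "bij_betw f B C"
    using real_fun.bij_if_span_eq_span_bases[of B C] assms C by blast
  then show ?thesis
    using bij_betw_finite[OF f] bij_betw_same_card[OF f] by (simp add: edim_def Let_def flip: C_def)
qed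

end

theory Submission
  imports Defs
begin

text \<open>
  If \<open>dim Q(G) \<ge> n\<close>, then linear algebra produces homogeneous quasimorphisms \<open>p\<^sub>0, \<dots>, p\<^sub>n\<^sub>-\<^sub>1\<close>
  and group elements \<open>g\<^sub>0, \<dots>, g\<^sub>n\<^sub>-\<^sub>1\<close> with \<open>p\<^sub>i(g\<^sub>j) = \<delta>\<^sub>i\<^sub>j\<close> (lemma \<open>biorthogonal_system\<close>): functions
  that are linearly independent can be told apart by as many points. The embedding is
  \<open>x \<mapsto> g\<^sub>0\<^bsup>x 0\<^esup> \<cdots> g\<^sub>n\<^sub>-\<^sub>1\<^bsup>x (n - 1)\<^esup>\<close>. It does not depend on the generating set.

  It is Lipschitz because the metric is biinvariant: two ordered products are compared factor by
  factor, and the \<open>i\<close>-th factors are at distance \<open>\<parallel>g\<^sub>i\<^bsup>x i - y i\<^esup>\<parallel> \<le> K\<^sub>i \<bar>x i - y i\<bar>\<close>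
  (lemma \<open>word_norm_power_product_le\<close>). Although the \<open>g\<^sub>i\<close> need not commute, no commutators
  have to be paid for.

  It does not contract distances too much because every homogeneous quasimorphism is bounded on a
  finite union of conjugacy classes, hence grows at most linearly in the word norm
  (lemma \<open>quasimorphism_word_norm_bound\<close>), while \<open>p\<^sub>j\<close> reads off the \<open>j\<close>-th exponent of an ordered
  product up to an error that depends on \<open>n\<close> and on the defect of \<open>p\<^sub>j\<close> only
  (lemma \<open>quasimorphism_power_product_diff\<close>). Summing over \<open>j\<close> bounds the
  \<open>\<ell>\<^sup>1\<close>-distance, which is the word metric of \<open>\<int>\<^sup>n\<close>, by a multiple of the distance in \<open>G\<close>
  plus a constant.
\<close>

section \<open>Word norms\<close>

context group
begin

lemma foldr_mult_closed:
  "set ss \<subseteq> carrier G \<Longrightarrow> foldr (\<otimes>) ss \<one> \<in> carrier G"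
  by (induction ss) auto

lemma foldr_mult_append:
  assumes "set ss \<subseteq> carrier G" "set ts \<subseteq> carrier G"
  shows "foldr (\<otimes>) (ss @ ts) \<one> = foldr (\<otimes>) ss \<one> \<otimes> foldr (\<otimes>) ts \<one>"
  using assms(1)
proof (induction ss)
  case Nil
  then show ?case using foldr_mult_closed[OF assms(2)] by simp
next
  case (Cons s ss)
  then have "s \<in> carrier G" "foldr (\<otimes>) ss \<one> \<in> carrier G"
    using foldr_mult_closed[of ss] by auto
  with Cons show ?case using foldr_mult_closed[OF assms(2)] by (simp add: m_assoc)
qed

lemma word_norm_le:
  "set ss \<subseteq> T \<Longrightarrow> word_norm G T (foldr (\<otimes>) ss \<one>) \<le> length ss"
  unfolding word_norm_def by (rule Least_le) blast

lemma word_norm_one [simp]: "word_norm G T \<one> = 0"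
  using word_norm_le[of "[]" T] by simp

lemma word_norm_attained_of_word:
  assumes "set us \<subseteq> T"
  shows "\<exists>ss. length ss = word_norm G T (foldr (\<otimes>) us \<one>) \<and> set ss \<subseteq> T
    \<and> foldr (\<otimes>) ss \<one> = foldr (\<otimes>) us \<one>"
  unfolding word_norm_def by (rule LeastI_ex) (use assms in blast)

lemma ex_word:
  assumes T: "T \<subseteq> carrier G" "\<And>t. t \<in> T \<Longrightarrow> inv t \<in> T" and g: "g \<in> generate G T"
  shows "\<exists>us. set us \<subseteq> T \<and> foldr (\<otimes>) us \<one> = g"
  using g
proof (induction rule: generate.induct)
  case one
  show ?case by (rule exI[of _ "[]"]) simp
next
  case (incl h)
  then show ?case using T by (intro exI[of _ "[h]"]) auto
next
  case (inv h)
  then show ?case using T by (intro exI[of _ "[inv h]"]) auto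
next
  case (eng g h)
  then obtain us vs where "set us \<subseteq> T" "foldr (\<otimes>) us \<one> = g" "set vs \<subseteq> T" "foldr (\<otimes>) vs \<one> = h"
    by blast
  then show ?case
    using T foldr_mult_append[of us vs] by (intro exI[of _ "us @ vs"]) auto
qed

end

locale symmetric_generating_set = group G for G (structure) +
  fixes T :: "'a set"
  assumes subset_carrier: "T \<subseteq> carrier G"
    and inv_mem: "t \<in> T \<Longrightarrow> inv t \<in> T"
    and generates: "generate G T = carrier G"
begin

lemma word_norm_attained:
  assumes "g \<in> carrier G"
  obtains ss where "length ss = word_norm G T g" "set ss \<subseteq> T" "foldr (\<otimes>) ss \<one> = g"
proof -
  obtain us where "set us \<subseteq> T" "foldr (\<otimes>) us \<one> = g"
    using ex_word[OF subset_carrier inv_mem, of g] assms generates by auto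
  then show ?thesis
    using word_norm_attained_of_word[of us T] that by auto
qed

lemma word_norm_mult_le:
  assumes "g \<in> carrier G" "h \<in> carrier G"
  shows "word_norm G T (g \<otimes> h) \<le> word_norm G T g + word_norm G T h"
proof -
  obtain ss where ss: "length ss = word_norm G T g" "set ss \<subseteq> T" "foldr (\<otimes>) ss \<one> = g"
    using word_norm_attained[OF assms(1)] .
  obtain ts where ts: "length ts = word_norm G T h" "set ts \<subseteq> T" "foldr (\<otimes>) ts \<one> = h"
    using word_norm_attained[OF assms(2)] .
  show ?thesis
    using word_norm_le[of "ss @ ts" T] foldr_mult_append[of ss ts] ss ts subset_carrier by auto
qed

lemma word_norm_nat_pow_le:
  assumes "g \<in> carrier G"
  shows "word_norm G T (g [^] (k::nat)) \<le> k * word_norm G T g"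
proof (induction k)
  case (Suc k)
  show ?case
    using word_norm_mult_le[of "g [^] k" g] Suc assms by simp
qed simp

lemma word_norm_int_pow_le:
  assumes g: "g \<in> carrier G"
  shows "real (word_norm G T (g [^] (k::int)))
    \<le> real (word_norm G T g + word_norm G T (inv g)) * real_of_int \<bar>k\<bar>"
proof -
  have "word_norm G T (g [^] k) \<le> nat \<bar>k\<bar> * (word_norm G T g + word_norm G T (inv g))"
  proof (cases k rule: int_cases2)
    case (nonneg m)
    then have "g [^] k = g [^] m" by (simp only: int_pow_int)
    then show ?thesis
      using word_norm_nat_pow_le[OF g, of m] nonneg by (simp add: add_mult_distrib2)
  next
    case (nonpos m)
    then have "g [^] k = inv g [^] m"
      using g by (simp only: int_pow_neg_int nat_pow_inv)
    then show ?thesis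
      using word_norm_nat_pow_le[of "inv g" m] g nonpos by (simp add: add_mult_distrib2)
  qed
  then have "real (word_norm G T (g [^] k))
      \<le> real (nat \<bar>k\<bar> * (word_norm G T g + word_norm G T (inv g)))"
    by (simp only: of_nat_le_iff)
  then show ?thesis by (simp add: mult.commute)
qed

end

locale conjugation_invariant_generating_set = symmetric_generating_set +
  assumes conjugation_mem: "a \<in> carrier G \<Longrightarrow> t \<in> T \<Longrightarrow> a \<otimes> t \<otimes> inv a \<in> T"
begin

lemma word_norm_conjugate_le:
  assumes a: "a \<in> carrier G" and g: "g \<in> carrier G"
  shows "word_norm G T (a \<otimes> g \<otimes> inv a) \<le> word_norm G T g"
proof -
  obtain ss where ss: "length ss = word_norm G T g" "set ss \<subseteq> T" "foldr (\<otimes>) ss \<one> = g"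
    using word_norm_attained[OF g] .
  let ?c = "\<lambda>t. a \<otimes> t \<otimes> inv a"
  have "foldr (\<otimes>) (map ?c us) \<one> = a \<otimes> foldr (\<otimes>) us \<one> \<otimes> inv a" if "set us \<subseteq> T" for us
    using that
  proof (induction us)
    case (Cons u us)
    have u: "u \<in> carrier G" and p: "foldr (\<otimes>) us \<one> \<in> carrier G"
      using Cons.prems subset_carrier foldr_mult_closed[of us] by auto
    have "?c u \<otimes> ?c v = ?c (u \<otimes> v)" if "v \<in> carrier G" for v
      using a u that by (simp add: m_assoc inv_solve_left')
    then show ?case using Cons p by simp
  qed (use a in simp)
  moreover have "set (map ?c ss) \<subseteq> T"
    using ss conjugation_mem[OF a] by auto
  ultimately show ?thesis
    using word_norm_le[of "map ?c ss" T] ss by simp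
qed

end

lemma conjugates_conjugation_invariant_generating_set:
  assumes "group G" "finite_normal_generating_set G S"
  shows "conjugation_invariant_generating_set G (conjugates G S)"
proof -
  interpret group G by fact
  have S: "S \<subseteq> carrier G" "set_inv\<^bsub>G\<^esub> S = S" "generate G (conjugates G S) = carrier G"
    using assms(2) by (auto simp: finite_normal_generating_set_def)
  show ?thesis
  proof
    show "conjugates G S \<subseteq> carrier G"
      using S by (auto simp: conjugates_def)
    show "generate G (conjugates G S) = carrier G" by fact
  next
    fix t assume "t \<in> conjugates G S"
    then obtain g s where g: "g \<in> carrier G" "s \<in> S" and t: "t = g \<otimes>\<^bsub>G\<^esub> s \<otimes>\<^bsub>G\<^esub> inv\<^bsub>G\<^esub> g"
      by (auto simp: conjugates_def)
    have "inv\<^bsub>G\<^esub> s \<in> S"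
      using S(2) g(2) by (auto simp: SET_INV_def)
    moreover have "inv\<^bsub>G\<^esub> t = g \<otimes>\<^bsub>G\<^esub> inv\<^bsub>G\<^esub> s \<otimes>\<^bsub>G\<^esub> inv\<^bsub>G\<^esub> g"
      using g S(1) by (auto simp: t inv_mult_group m_assoc subset_iff)
    ultimately show "inv\<^bsub>G\<^esub> t \<in> conjugates G S"
      using g(1) by (auto simp: conjugates_def)
    fix a assume a: "a \<in> carrier G"
    have "a \<otimes>\<^bsub>G\<^esub> t \<otimes>\<^bsub>G\<^esub> inv\<^bsub>G\<^esub> a = (a \<otimes>\<^bsub>G\<^esub> g) \<otimes>\<^bsub>G\<^esub> s \<otimes>\<^bsub>G\<^esub> inv\<^bsub>G\<^esub> (a \<otimes>\<^bsub>G\<^esub> g)"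
      using g a S(1) by (auto simp: t inv_mult_group m_assoc subset_iff)
    then show "a \<otimes>\<^bsub>G\<^esub> t \<otimes>\<^bsub>G\<^esub> inv\<^bsub>G\<^esub> a \<in> conjugates G S"
      using a g unfolding conjugates_def by blast
  qed
qed

section \<open>The word metric of \<open>\<int>\<^sup>n\<close>\<close>

lemma group_Zn: "group (Zn n)"
  by (simp add: Zn_def)

lemma carrier_Zn: "carrier (Zn n) = {..<n} \<rightarrow>\<^sub>E UNIV"
  by (simp add: Zn_def)

lemma mult_Zn: "x \<otimes>\<^bsub>Zn n\<^esub> y = (\<lambda>i\<in>{..<n}. x i + y i)"
  by (simp add: Zn_def)

lemma one_Zn: "\<one>\<^bsub>Zn n\<^esub> = (\<lambda>i\<in>{..<n}. 0)"
  by (simp add: Zn_def)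

lemma inv_Zn: "x \<in> carrier (Zn n) \<Longrightarrow> inv\<^bsub>Zn n\<^esub> x = (\<lambda>i\<in>{..<n}. - x i)"
  by (simp add: Zn_def)

lemma l1_norm_Zn_word_le:
  assumes "set ss \<subseteq> Zn_generators n"
  shows "(\<Sum>i<n. \<bar>foldr (\<otimes>\<^bsub>Zn n\<^esub>) ss \<one>\<^bsub>Zn n\<^esub> i\<bar>) \<le> int (length ss)"
  using assms
proof (induction ss)
  case (Cons s ss)
  define z where "z = foldr (\<otimes>\<^bsub>Zn n\<^esub>) ss \<one>\<^bsub>Zn n\<^esub>"
  obtain j c where s: "s = (\<lambda>i\<in>{..<n}. if i = j then c else 0)" and j: "j < n" "c \<in> {1, -1}"
    using Cons.prems by (auto simp: Zn_generators_def)
  have "(\<Sum>i<n. \<bar>(s \<otimes>\<^bsub>Zn n\<^esub> z) i\<bar>) \<le> (\<Sum>i<n. (if i = j then 1 else 0) + \<bar>z i\<bar>)"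
    by (rule sum_mono) (use j in \<open>auto simp: mult_Zn s\<close>)
  also have "\<dots> = 1 + (\<Sum>i<n. \<bar>z i\<bar>)"
    using j by (simp add: sum.distrib)
  finally show ?case using Cons by (simp add: z_def)
qed (simp add: one_Zn)

text \<open>
  Moving one nonzero coordinate one step towards \<open>0\<close> strips one generator and lowers the
  \<open>\<ell>\<^sup>1\<close>-norm by one.
\<close>

lemma ex_Zn_word_of_l1_norm:
  assumes "z \<in> carrier (Zn n)" "(\<Sum>i<n. \<bar>z i\<bar>) = int k"
  shows "\<exists>ss. length ss = k \<and> set ss \<subseteq> Zn_generators n \<and> foldr (\<otimes>\<^bsub>Zn n\<^esub>) ss \<one>\<^bsub>Zn n\<^esub> = z"
  using assms
proof (induction k arbitrary: z)
  case 0
  then have "\<forall>i<n. z i = 0"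
    using sum_nonneg_eq_0_iff[of "{..<n}" "\<lambda>i. \<bar>z i\<bar>"] by auto
  then have "z = \<one>\<^bsub>Zn n\<^esub>"
    using 0 by (auto simp: one_Zn carrier_Zn PiE_def extensional_def fun_eq_iff)
  then show ?case by (intro exI[of _ "[]"]) simp
next
  case (Suc k)
  obtain j where j: "j < n" "z j \<noteq> 0"
  proof (rule ccontr)
    assume "\<not> thesis"
    then have "(\<Sum>i<n. \<bar>z i\<bar>) = 0" using that by (intro sum.neutral) auto
    then show False using Suc.prems by simp
  qed
  define e where "e = (\<lambda>i\<in>{..<n}. if i = j then sgn (z j) else 0)"
  define y where "y = (\<lambda>i\<in>{..<n}. z i - e i)"
  have e: "e \<in> Zn_generators n"
    unfolding Zn_generators_def e_def using j
    by (intro CollectI exI[of _ j] exI[of _ "sgn (z j)"]) (auto simp: sgn_if)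
  have y: "y \<in> carrier (Zn n)"
    by (auto simp: carrier_Zn y_def)
  have "(\<Sum>i<n. \<bar>y i\<bar>) = (\<Sum>i<n. \<bar>z i\<bar> - (if i = j then 1 else 0))"
    by (rule sum.cong) (use j in \<open>auto simp: y_def e_def sgn_if\<close>)
  also have "\<dots> = int k"
    using Suc.prems j by (simp add: sum_subtractf)
  finally obtain ss where ss: "length ss = k" "set ss \<subseteq> Zn_generators n"
    "foldr (\<otimes>\<^bsub>Zn n\<^esub>) ss \<one>\<^bsub>Zn n\<^esub> = y"
    using Suc.IH[OF y] by blast
  have "e \<otimes>\<^bsub>Zn n\<^esub> y = z"
    using Suc.prems(1) by (auto simp: mult_Zn y_def carrier_Zn PiE_def extensional_def fun_eq_iff)
  then show ?case using ss e by (intro exI[of _ "e # ss"]) auto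
qed

lemma word_norm_Zn:
  assumes z: "z \<in> carrier (Zn n)"
  shows "int (word_norm (Zn n) (Zn_generators n) z) = (\<Sum>i<n. \<bar>z i\<bar>)"
proof -
  interpret group "Zn n" by (rule group_Zn)
  obtain us where us: "length us = nat (\<Sum>i<n. \<bar>z i\<bar>)" "set us \<subseteq> Zn_generators n"
    "foldr (\<otimes>\<^bsub>Zn n\<^esub>) us \<one>\<^bsub>Zn n\<^esub> = z"
    using ex_Zn_word_of_l1_norm[OF z, of "nat (\<Sum>i<n. \<bar>z i\<bar>)"] by (auto simp: sum_nonneg)
  obtain ss where ss: "length ss = word_norm (Zn n) (Zn_generators n) z"
    "set ss \<subseteq> Zn_generators n" "foldr (\<otimes>\<^bsub>Zn n\<^esub>) ss \<one>\<^bsub>Zn n\<^esub> = z"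
    using word_norm_attained_of_word[OF us(2)] us(3) by auto
  have "int (word_norm (Zn n) (Zn_generators n) z) \<le> (\<Sum>i<n. \<bar>z i\<bar>)"
    using word_norm_le[OF us(2)] us by (simp add: le_nat_iff sum_nonneg)
  moreover have "(\<Sum>i<n. \<bar>z i\<bar>) \<le> int (word_norm (Zn n) (Zn_generators n) z)"
    using l1_norm_Zn_word_le[OF ss(2)] ss by simp
  ultimately show ?thesis by simp
qed

lemma Zn_metric_eq_l1:
  assumes "x \<in> carrier (Zn n)" "y \<in> carrier (Zn n)"
  shows "Zn_metric n x y = (\<Sum>i<n. real_of_int \<bar>x i - y i\<bar>)"
proof -
  interpret group "Zn n" by (rule group_Zn)
  have "int (word_norm (Zn n) (Zn_generators n) (x \<otimes>\<^bsub>Zn n\<^esub> inv\<^bsub>Zn n\<^esub> y)) = (\<Sum>i<n. \<bar>x i - y i\<bar>)"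
    using assms by (subst word_norm_Zn) (simp_all add: mult_Zn inv_Zn carrier_Zn)
  then have "real_of_int (int (word_norm (Zn n) (Zn_generators n) (x \<otimes>\<^bsub>Zn n\<^esub> inv\<^bsub>Zn n\<^esub> y)))
      = real_of_int (\<Sum>i<n. \<bar>x i - y i\<bar>)"
    by (rule arg_cong)
  then show ?thesis
    by (simp add: Zn_metric_def word_metric_def)
qed

section \<open>Points separating independent functions\<close>

text \<open>
  A Gram-Schmidt process, with points in place of inner products: subtracting from a further
  basis element its interpolation at the points found so far leaves a function that is nonzero by
  independence, hence nonzero at some new point; the old functions are then corrected to vanish
  there.
\<close>

lemma biorthogonal_system_of_independent:
  fixes B :: "('a \<Rightarrow> real) set"
  assumes "finite B" "real_fun.independent B"
  shows "\<exists>p x. (\<forall>i<card B. p i \<in> real_fun.span B)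
    \<and> (\<forall>i<card B. \<forall>j<card B. p i (x j) = (if i = j then 1 else 0))"
  using assms
proof (induction rule: finite_induct)
  case (insert b B)
  define m where "m = card B"
  have indep: "b \<notin> real_fun.span B" "real_fun.independent B"
    using insert.prems insert.hyps by (auto simp: real_fun.independent_insert)
  obtain p x where p: "\<And>i. i < m \<Longrightarrow> p i \<in> real_fun.span B"
    and px: "\<And>i j. i < m \<Longrightarrow> j < m \<Longrightarrow> p i (x j) = (if i = j then 1 else 0)"
    using insert.IH[OF indep(2)] unfolding m_def by blast
  define r where "r = b - (\<Sum>i<m. scale_fun (b (x i)) (p i))"
  have sum_apply: "(\<Sum>i<m. scale_fun (b (x i)) (p i)) y = (\<Sum>i<m. b (x i) * p i y)" for y
    by (induction m) (auto simp: scale_fun_def)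
  have r_zero: "r (x j) = 0" if "j < m" for j
  proof -
    have "(\<Sum>i<m. b (x i) * p i (x j)) = (\<Sum>i<m. if i = j then b (x i) else 0)"
      by (rule sum.cong) (use px that in auto)
    then show ?thesis using that by (simp add: r_def sum_apply)
  qed
  have "(\<Sum>i<m. scale_fun (b (x i)) (p i)) \<in> real_fun.span B"
    by (intro real_fun.span_sum real_fun.span_scale p) auto
  then have "r \<noteq> 0" using indep(1) by (auto simp: r_def)
  then obtain y where y: "r y \<noteq> 0" by (auto simp: fun_eq_iff)
  have mono: "real_fun.span B \<subseteq> real_fun.span (insert b B)"
    by (rule real_fun.span_mono) auto
  define r' where "r' = scale_fun (1 / r y) r"
  define p' where "p' = (\<lambda>i. if i = m then r' else p i - scale_fun (p i y) r')"
  define x' where "x' = x(m := y)"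
  have r': "r' \<in> real_fun.span (insert b B)"
    unfolding r'_def r_def
    by (intro real_fun.span_scale real_fun.span_diff real_fun.span_sum)
      (use p mono in \<open>auto intro: real_fun.span_base\<close>)
  have "p' i \<in> real_fun.span (insert b B)" if "i < Suc m" for i
    using that r' p mono
    by (auto simp: p'_def intro!: real_fun.span_diff real_fun.span_scale)
  moreover have "p' i (x' j) = (if i = j then 1 else 0)" if "i < Suc m" "j < Suc m" for i j
    using that px r_zero y by (auto simp: p'_def x'_def r'_def scale_fun_def less_Suc_eq)
  ultimately show ?case
    using insert.hyps by (auto simp: m_def intro!: exI[of _ p'] exI[of _ x'])
qed simp

lemma biorthogonal_system:
  fixes V :: "('a \<Rightarrow> real) set"
  assumes V: "real_fun.subspace V" and "edim V \<ge> enat n"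
  obtains p x where "\<And>i. i < n \<Longrightarrow> p i \<in> V"
    "\<And>i j. i < n \<Longrightarrow> j < n \<Longrightarrow> p i (x j) = (if i = j then 1 else 0)"
proof -
  obtain B where B: "B \<subseteq> V" "real_fun.independent B" "V \<subseteq> real_fun.span B"
    using real_fun.maximal_independent_subset[of V] by blast
  have "\<exists>C\<subseteq>B. finite C \<and> card C = n"
  proof (cases "finite B")
    case True
    then have "n \<le> card B" using assms(2) edim_eq_basis[OF B] by simp
    then show ?thesis using obtain_subset_with_card_n[of n B] by metis
  next
    case False
    then show ?thesis using infinite_arbitrarily_large[of B n] by blast
  qed
  then obtain C where C: "C \<subseteq> B" "finite C" "card C = n" by blast
  have "real_fun.independent C"
    using real_fun.independent_mono[OF B(2) C(1)] .
  moreover have "real_fun.span C \<subseteq> V"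
    using B C V by (intro real_fun.span_minimal) auto
  ultimately show ?thesis
    using biorthogonal_system_of_independent[of C] C that by blast
qed

section \<open>Ordered products of powers\<close>

primrec power_product ::
    "('a, 'b) monoid_scheme \<Rightarrow> (nat \<Rightarrow> 'a) \<Rightarrow> (nat \<Rightarrow> int) \<Rightarrow> nat \<Rightarrow> 'a"
  where
    "power_product G g x 0 = \<one>\<^bsub>G\<^esub>"
  | "power_product G g x (Suc m) = power_product G g x m \<otimes>\<^bsub>G\<^esub> g m [^]\<^bsub>G\<^esub> x m"

lemma (in group) power_product_closed:
  "(\<And>i. i < m \<Longrightarrow> g i \<in> carrier G) \<Longrightarrow> power_product G g x m \<in> carrier G"
  by (induction m) auto

text \<open>
  With \<open>P = P' g\<^bsup>a\<^esup>\<close> and \<open>R = R' g\<^bsup>b\<^esup>\<close> one has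
  \<open>P R\<^sup>-\<^sup>1 = (P' R'\<^sup>-\<^sup>1) (R' g\<^bsup>a - b\<^esup> R'\<^sup>-\<^sup>1)\<close>, and conjugation does not increase the norm.
\<close>

lemma (in conjugation_invariant_generating_set) word_norm_power_product_le:
  assumes "\<And>i. i < m \<Longrightarrow> g i \<in> carrier G"
  shows "word_norm G T (power_product G g x m \<otimes> inv (power_product G g y m))
    \<le> (\<Sum>i<m. word_norm G T (g i [^] (x i - y i)))"
  using assms
proof (induction m)
  case (Suc m)
  let ?P = "power_product G g x m" and ?R = "power_product G g y m"
  have PR: "?P \<in> carrier G" "?R \<in> carrier G"
    using Suc.prems by (auto intro!: power_product_closed)
  have g: "g m \<in> carrier G" using Suc.prems by simp
  have inv_cancel: "inv ?R \<otimes> (?R \<otimes> h) = h" if "h \<in> carrier G" for h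
    using PR that by (simp flip: m_assoc)
  have "?P \<otimes> g m [^] x m \<otimes> inv (?R \<otimes> g m [^] y m)
      = ?P \<otimes> (g m [^] x m \<otimes> inv (g m [^] y m)) \<otimes> inv ?R"
    using PR g by (simp add: inv_mult_group m_assoc)
  also have "\<dots> = (?P \<otimes> inv ?R) \<otimes> (?R \<otimes> g m [^] (x m - y m) \<otimes> inv ?R)"
    using PR g by (simp add: int_pow_diff m_assoc inv_cancel)
  finally have "power_product G g x (Suc m) \<otimes> inv (power_product G g y (Suc m))
      = (?P \<otimes> inv ?R) \<otimes> (?R \<otimes> g m [^] (x m - y m) \<otimes> inv ?R)"
    by simp
  then show ?case
    using word_norm_mult_le[of "?P \<otimes> inv ?R" "?R \<otimes> g m [^] (x m - y m) \<otimes> inv ?R"]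
      word_norm_conjugate_le[of ?R "g m [^] (x m - y m)"] Suc PR g by fastforce
qed simp

section \<open>Homogeneous quasimorphisms\<close>

locale homogeneous_quasimorphism = group G for G (structure) +
  fixes q :: "'a \<Rightarrow> real" and A :: real
  assumes defect: "g \<in> carrier G \<Longrightarrow> h \<in> carrier G \<Longrightarrow> \<bar>q (g \<otimes> h) - q g - q h\<bar> \<le> A"
    and int_pow: "g \<in> carrier G \<Longrightarrow> q (g [^] (k::int)) = of_int k * q g"
begin

lemma one_eq_0: "q \<one> = 0"
  using int_pow[of \<one> 0] by simp

lemma inv_eq_uminus: "g \<in> carrier G \<Longrightarrow> q (inv g) = - q g"
  using int_pow[of g "-1"] by (simp add: int_pow_neg)

text \<open>
  Homogeneity makes \<open>q\<close> odd, so the contributions of \<open>g\<close> and \<open>g\<^sup>-\<^sup>1\<close> cancel and only two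
  defects remain; this makes \<open>q\<close> bounded on a whole conjugacy class.
\<close>

lemma conjugate_bound:
  assumes "g \<in> carrier G" "s \<in> carrier G"
  shows "\<bar>q (g \<otimes> s \<otimes> inv g)\<bar> \<le> \<bar>q s\<bar> + 2 * A"
  using defect[of "g \<otimes> s" "inv g"] defect[of g s] inv_eq_uminus[of g] assms by auto

lemma word_bound:
  assumes "T \<subseteq> carrier G" "\<And>t. t \<in> T \<Longrightarrow> \<bar>q t\<bar> \<le> M" "set ss \<subseteq> T"
  shows "\<bar>q (foldr (\<otimes>) ss \<one>)\<bar> \<le> real (length ss) * (M + A)"
  using assms(3)
proof (induction ss)
  case (Cons s ss)
  then have "s \<in> T" "s \<in> carrier G" "foldr (\<otimes>) ss \<one> \<in> carrier G"
    using assms(1) foldr_mult_closed[of ss] by auto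
  then show ?case
    using defect[of s "foldr (\<otimes>) ss \<one>"] assms(2)[of s] Cons by (auto simp: algebra_simps)
qed (simp add: one_eq_0)

lemma quasimorphism_word_norm_bound:
  assumes S: "finite_normal_generating_set G S"
  shows "\<exists>L\<ge>0. \<forall>g\<in>carrier G. \<bar>q g\<bar> \<le> L * real (word_norm G (conjugates G S) g)"
proof -
  interpret conjugation_invariant_generating_set G "conjugates G S"
    using conjugates_conjugation_invariant_generating_set[OF is_group S] .
  have fin: "finite S" "S \<subseteq> carrier G"
    using S by (auto simp: finite_normal_generating_set_def)
  define M where "M = (\<Sum>s\<in>S. \<bar>q s\<bar>) + 2 * A"
  have A: "A \<ge> 0" using defect[of \<one> \<one>] by simp
  have M: "\<bar>q t\<bar> \<le> M" if t: "t \<in> conjugates G S" for t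
  proof -
    obtain g s where gs: "g \<in> carrier G" "s \<in> S" "t = g \<otimes> s \<otimes> inv g"
      using t by (auto simp: conjugates_def)
    have "\<bar>q s\<bar> \<le> (\<Sum>s\<in>S. \<bar>q s\<bar>)"
      using fin gs by (intro member_le_sum) auto
    then show ?thesis
      using conjugate_bound[of g s] gs fin by (auto simp: M_def)
  qed
  have "\<bar>q g\<bar> \<le> (M + A) * real (word_norm G (conjugates G S) g)" if g: "g \<in> carrier G" for g
  proof -
    obtain ss where ss: "length ss = word_norm G (conjugates G S) g"
      "set ss \<subseteq> conjugates G S" "foldr (\<otimes>) ss \<one> = g"
      using word_norm_attained[OF g] .
    show ?thesis
      using word_bound[OF subset_carrier M ss(2)] ss by (simp add: mult.commute)
  qed
  moreover have "M + A \<ge> 0" using A by (simp add: M_def sum_nonneg)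
  ultimately show ?thesis by blast
qed

lemma quasimorphism_power_product:
  assumes "\<And>i. i < m \<Longrightarrow> g i \<in> carrier G"
  shows "\<bar>q (power_product G g x m) - (\<Sum>i<m. of_int (x i) * q (g i))\<bar> \<le> real m * A"
  using assms
proof (induction m)
  case (Suc m)
  have "power_product G g x m \<in> carrier G" "g m \<in> carrier G"
    using Suc.prems by (auto intro!: power_product_closed)
  then show ?case
    using defect[of "power_product G g x m" "g m [^] x m"] int_pow[of "g m" "x m"] Suc
    by (auto simp: algebra_simps)
qed (simp add: one_eq_0)

lemma quasimorphism_power_product_diff:
  assumes "\<And>i. i < m \<Longrightarrow> g i \<in> carrier G"
  shows "\<bar>q (power_product G g x m \<otimes> inv (power_product G g y m))
      - (\<Sum>i<m. of_int (x i - y i) * q (g i))\<bar> \<le> (2 * real m + 1) * A"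
proof -
  have "power_product G g z m \<in> carrier G" for z
    using assms by (rule power_product_closed)
  then show ?thesis
    using defect[of "power_product G g x m" "inv (power_product G g y m)"]
      inv_eq_uminus[of "power_product G g y m"]
      quasimorphism_power_product[where m = m and g = g and x = x, OF assms]
      quasimorphism_power_product[where m = m and g = g and x = y, OF assms]
    by (simp add: algebra_simps sum_subtractf)
qed

end

lemma homogeneous_quasimorphism_of_Q:
  assumes "group G" "q \<in> Q G"
  obtains A where "homogeneous_quasimorphism G q A"
  using assms
  unfolding Q_def quasimorphism_def homogeneous_def homogeneous_quasimorphism_def
    homogeneous_quasimorphism_axioms_def by blast

section \<open>The embedding\<close>

text \<open>
  The multiplicative constant \<open>K + L + 1\<close> serves both inequalities: \<open>K\<close> is the sum of the norms of
  all \<open>g\<^sub>i\<close> and their inverses, which bounds the expansion, and \<open>L\<close> is the sum of the linear growth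
  rates of the \<open>p\<^sub>j\<close>, which bounds the contraction.
\<close>

lemma power_product_quasiisometric_embedding:
  assumes "group G" and S: "finite_normal_generating_set G S"
    and p: "\<And>j. j < n \<Longrightarrow> p j \<in> Q G" and g: "\<And>i. i < n \<Longrightarrow> g i \<in> carrier G"
    and pg: "\<And>i j. i < n \<Longrightarrow> j < n \<Longrightarrow> p i (g j) = (if i = j then 1 else 0)"
  shows "quasiisometric_embedding (carrier (Zn n)) (Zn_metric n)
    (carrier G) (biinvariant_word_metric G S) (\<lambda>x. power_product G g x n)"
proof -
  interpret conjugation_invariant_generating_set G "conjugates G S"
    using conjugates_conjugation_invariant_generating_set[OF assms(1) S] .
  let ?N = "word_norm G (conjugates G S)"
  let ?F = "\<lambda>x. power_product G g x n"
  have "\<exists>A. homogeneous_quasimorphism G (p j) A" if "j < n" for j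
    using homogeneous_quasimorphism_of_Q[OF assms(1) p[OF that]] by blast
  then obtain A where A: "\<And>j. j < n \<Longrightarrow> homogeneous_quasimorphism G (p j) (A j)"
    by metis
  have "\<exists>L\<ge>0. \<forall>h\<in>carrier G. \<bar>p j h\<bar> \<le> L * real (?N h)" if "j < n" for j
    using homogeneous_quasimorphism.quasimorphism_word_norm_bound[OF A[OF that] S] .
  then obtain L where L0: "\<And>j. j < n \<Longrightarrow> L j \<ge> 0"
    and L: "\<And>j h. j < n \<Longrightarrow> h \<in> carrier G \<Longrightarrow> \<bar>p j h\<bar> \<le> L j * real (?N h)"
    by metis
  define k where "k = (\<lambda>i. real (?N (g i) + ?N (inv\<^bsub>G\<^esub> g i)))"
  define D where "D = (\<Sum>j<n. (2 * real n + 1) * \<bar>A j\<bar>)"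
  define C where "C = sum k {..<n} + sum L {..<n} + 1"
  have k0: "k i \<ge> 0" for i by (simp add: k_def)
  have sums0: "sum k {..<n} \<ge> 0" "sum L {..<n} \<ge> 0" "D \<ge> 0"
    using k0 L0 by (auto simp: D_def intro!: sum_nonneg)
  then have C1: "C \<ge> 1" by (simp add: C_def)
  have F: "?F x \<in> carrier G" for x
    using g by (rule power_product_closed)
  have bounds: "1 / C * Zn_metric n x y - D \<le> biinvariant_word_metric G S (?F x) (?F y)
      \<and> biinvariant_word_metric G S (?F x) (?F y) \<le> C * Zn_metric n x y + D"
    if xy: "x \<in> carrier (Zn n)" "y \<in> carrier (Zn n)" for x y
  proof -
    define w where "w = ?F x \<otimes>\<^bsub>G\<^esub> inv\<^bsub>G\<^esub> ?F y"
    have w: "w \<in> carrier G" using F by (simp add: w_def)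
    have dG: "biinvariant_word_metric G S (?F x) (?F y) = real (?N w)"
      by (simp add: biinvariant_word_metric_def word_metric_def w_def)
    let ?d = "\<lambda>i. real_of_int \<bar>x i - y i\<bar>"
    have dZ: "Zn_metric n x y = (\<Sum>i<n. ?d i)" using Zn_metric_eq_l1[OF xy] .
    have dZ0: "Zn_metric n x y \<ge> 0" by (simp add: dZ sum_nonneg)
    have "real (?N w) \<le> real (\<Sum>i<n. ?N (g i [^]\<^bsub>G\<^esub> (x i - y i)))"
      unfolding w_def of_nat_le_iff using g by (rule word_norm_power_product_le)
    also have "\<dots> \<le> (\<Sum>i<n. k i * ?d i)"
      unfolding of_nat_sum k_def using g by (intro sum_mono word_norm_int_pow_le) auto
    also have "\<dots> \<le> (\<Sum>i<n. sum k {..<n} * ?d i)"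
      using k0 by (intro sum_mono mult_right_mono member_le_sum) auto
    also have "\<dots> = sum k {..<n} * Zn_metric n x y"
      by (simp add: dZ sum_distrib_left)
    also have "\<dots> \<le> C * Zn_metric n x y"
      using dZ0 sums0 by (intro mult_right_mono) (auto simp: C_def)
    finally have upper: "real (?N w) \<le> C * Zn_metric n x y" .
    have "?d j \<le> L j * real (?N w) + (2 * real n + 1) * \<bar>A j\<bar>" if j: "j < n" for j
    proof -
      have "(\<Sum>i<n. of_int (x i - y i) * p j (g i)) = (\<Sum>i<n. if i = j then of_int (x i - y i) else 0)"
        by (rule sum.cong) (use pg j in auto)
      also have "\<dots> = of_int (x j - y j)" using j by simp
      finally have "\<bar>p j w - of_int (x j - y j)\<bar> \<le> (2 * real n + 1) * A j"
        using homogeneous_quasimorphism.quasimorphism_power_product_diff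
          [where m = n and g = g and x = x and y = y, OF A[OF j] g]
        by (simp add: w_def)
      also have "\<dots> \<le> (2 * real n + 1) * \<bar>A j\<bar>"
        by (intro mult_left_mono) auto
      finally show ?thesis using L[OF j w] by auto
    qed
    then have "Zn_metric n x y \<le> (\<Sum>j<n. L j * real (?N w) + (2 * real n + 1) * \<bar>A j\<bar>)"
      unfolding dZ by (intro sum_mono) auto
    also have "\<dots> = sum L {..<n} * real (?N w) + D"
      by (simp add: sum.distrib D_def sum_distrib_right)
    \<comment> \<open>The error is enlarged to \<open>C D\<close> so that it becomes \<open>D\<close> on division by \<open>C\<close>.\<close>
    also have "\<dots> \<le> C * real (?N w) + C * D"
      using sums0 C1 mult_right_mono[of 1 C D]
      by (intro add_mono mult_right_mono) (auto simp: C_def)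
    finally have "1 / C * Zn_metric n x y \<le> real (?N w) + D"
      using C1 by (simp add: field_simps)
    then show ?thesis using upper sums0 dG by simp
  qed
  show ?thesis
    unfolding quasiisometric_embedding_def using F C1 sums0(3) bounds by blast
qed

theorem theorem3p3:
  fixes G :: "('a, 'b) monoid_scheme" and n :: nat
  assumes "group G"
    and "normally_finitely_generated G"
    and "edim (Q G) \<ge> enat n"
  shows "\<exists>f :: (nat \<Rightarrow> int) \<Rightarrow> 'a. \<forall>S. finite_normal_generating_set G S \<longrightarrow>
    quasiisometric_embedding (carrier (Zn n)) (Zn_metric n)
      (carrier G) (biinvariant_word_metric G S) f"
proof -
  obtain p g where p: "\<And>i. i < n \<Longrightarrow> p i \<in> Q G"
    and pg: "\<And>i j. i < n \<Longrightarrow> j < n \<Longrightarrow> p i (g j) = (if i = j then 1 else 0)"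
    using biorthogonal_system[OF subspace_Q assms(3)] by blast
  \<comment> \<open>Members of \<open>Q G\<close> vanish off the carrier, whereas \<open>p i (g i) = 1\<close>.\<close>
  have "g i \<in> carrier G" if "i < n" for i
  proof (rule ccontr)
    assume "g i \<notin> carrier G"
    then have "p i (g i) = 0" using p[OF that] by (simp add: Q_def)
    then show False using pg[OF that that] by simp
  qed
  then show ?thesis
    using power_product_quasiisometric_embedding[OF assms(1) _ p _ pg] by blast
qed

end
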